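(* Let $A,B,H,K$ be any logically independent events. Given any assessment $(x,y)\in[0,1]^2$ on $\{A|H,B|K\}$, for the iterated conditional $(B|K)|_K(A|H)$ the extension $\mu_K=\mathbb{P}((B|K)|_K(A|H))$ is coherent if and only if $\mu_K\in[\mu_K',\mu_K'']$, where $$\mu_K'=0,\qquad \mu_K''=\begin{cases}\min\left\{1,\tfrac{y}{x}\right\}, & \text{if } x>0,\\ 1, & \text{if } x=0.\end{cases}$$
   Context: Events are two-valued entities identified with their indicators (values $1/0$); $\emptyset$ is the impossible event, $AB=A\wedge B$, $\overline{A}$ is the negation. Four events are logically independent if all $16$ conjunctions obtained by taking each event or its negation are different from $\emptyset$. For $H\neq\emptyset$ the conditional event $E|H$ is true if $EH$ is true, false if $\overline{E}H$ is true, void if $\overline{H}$ is true. Once $P(E|H)=p$ is assessed, $E|H$ is also the random quantity $EH+p\overline{H}$; numerically $\overline{A}|H=1-A|H$. Conjunction (a conditional event; the subscript $K$ is only a name, unrelated to the event $K$): $(A|H)\wedge_K(B|K)=AHBK|(HK\vee\overline{A}H\vee\overline{B}K)$. Iterated conditional: $(B|K)|_K(A|H)$ is the random quantity $(A|H)\wedge_K(B|K)+\mu_K\,(\overline{A}|H)$, where $\mu_K$ is its assessed prevision (the amount paid to receive it), the right-hand side being computed numerically from $x=P(A|H)$, $z=P[(A|H)\wedge_K(B|K)]$ and $\mu_K$. Also $y=P(B|K)$. Coherence: an assessment of real values $m_j$ on a finite family of such objects $X_j$ (conditional events, as random quantities, and iterated conditionals) is coherent iff for every nonempty subfamily $J$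 and all reals $s_j$, the random gain $\sum_{j\in J}s_j(X_j-m_j)$, restricted to the cases where at least one of the bets in $J$ is not called off, has minimum $\le 0$ and maximum $\ge 0$. A bet on a conditional event is called off when it is void; a bet on the iterated conditional is called off in the cases where one receives back the paid amount $\mu_K$ whatever it is (taking into account the relation $z=x\mu_K$ required by linearity of coherent previsions). The value $\mu_K$ is a coherent extension of $(x,y)$ iff there is $z$ such that $(x,y,z,\mu_K)$ is coherent on $\{A|H,B|K,(A|H)\wedge_K(B|K),(B|K)|_K(A|H)\}$. *)

theory Defs
  imports Complex_Main
begin

text \<open>Events are sets of outcomes of type \<open>'w\<close>; the sure event is \<^term>\<open>UNIV\<close>, the impossible
  event is \<^term>\<open>{}\<close>.\<close>

definition logically_independent :: "'w set \<Rightarrow> 'w set \<Rightarrow> 'w set \<Rightarrow> 'w set \<Rightarrow> bool" where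
  "logically_independent A B H K \<longleftrightarrow>
    (\<forall>A'\<in>{A, -A}. \<forall>B'\<in>{B, -B}. \<forall>H'\<in>{H, -H}. \<forall>K'\<in>{K, -K}. A' \<inter> B' \<inter> H' \<inter> K' \<noteq> {})"

text \<open>\<open>Cond E H\<close> stands for the conditional event $E|H$. It is meaningful for \<open>H \<noteq> {}\<close>; for the
  conditional events built from logically independent events this holds automatically.\<close>

datatype 'w cond_event = Cond "'w set" "'w set"

fun true_in :: "'w cond_event \<Rightarrow> 'w set" where
  "true_in (Cond E H) = E \<inter> H"

fun void_in :: "'w cond_event \<Rightarrow> 'w set" where
  "void_in (Cond E H) = -H"

definition cond_value :: "'w cond_event \<Rightarrow> real \<Rightarrow> 'w \<Rightarrow> real" where
  "cond_value X p w = of_bool (w \<in> true_in X) + p * of_bool (w \<in> void_in X)"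

fun conj_K :: "'w cond_event \<Rightarrow> 'w cond_event \<Rightarrow> 'w cond_event" where
  "conj_K (Cond A H) (Cond B K) =
    Cond (A \<inter> H \<inter> B \<inter> K) ((H \<inter> K) \<union> (-A \<inter> H) \<union> (-B \<inter> K))"

text \<open>\<open>iter_value Y X x z m\<close> is the iterated conditional $Y|_K X$, where \<open>x\<close>, \<open>z\<close> and \<open>m\<close> are the
  assessed previsions of \<open>X\<close>, of \<open>conj_K X Y\<close> and of the iterated conditional itself. The factor
  of \<open>m\<close> is the value of the negation of \<open>X\<close>.\<close>

definition iter_value :: "'w cond_event \<Rightarrow> 'w cond_event \<Rightarrow> real \<Rightarrow> real \<Rightarrow> real \<Rightarrow> 'w \<Rightarrow> real" where
  "iter_value Y X x z m w = cond_value (conj_K X Y) z w + m * (1 - cond_value X x w)"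

text \<open>The bet on $Y|_K X$ is called off in the cases where the amount paid is received back whatever
  it is, account being taken of \<open>z = x * m\<close>. These cases depend on \<open>x\<close>: for example, with
  \<open>X = Cond A H\<close> and \<open>Y = Cond B K\<close>, the amount received on \<open>-H \<inter> -B \<inter> K\<close> is \<open>m * (1 - x)\<close>, so
  that the bet is called off there exactly when \<open>x = 0\<close>.\<close>

definition iter_off :: "'w cond_event \<Rightarrow> 'w cond_event \<Rightarrow> real \<Rightarrow> 'w set" where
  "iter_off Y X x = {w. \<forall>m. iter_value Y X x (x * m) m w = m}"

record 'w bet =
  payoff :: "'w \<Rightarrow> real"
  called_off :: "'w set"
  price :: real

definition cond_bet :: "'w cond_event \<Rightarrow> real \<Rightarrow> 'w bet" where
  "cond_bet X p = \<lparr>payoff = cond_value X p, called_off = void_in X, price = p\<rparr>"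

definition iter_bet :: "'w cond_event \<Rightarrow> 'w cond_event \<Rightarrow> real \<Rightarrow> real \<Rightarrow> real \<Rightarrow> 'w bet" where
  "iter_bet Y X x z m =
    \<lparr>payoff = iter_value Y X x z m, called_off = iter_off Y X x, price = m\<rparr>"

text \<open>A family of bets is a list, so that equal bets at different positions remain distinct members.
  \<^const>\<open>Min\<close> and \<^const>\<open>Max\<close> are the actual minimum and maximum here: the quantities
  above, and hence their gains, take finitely many values, and for logically independent
  events no bet is called off in every case.\<close>

definition gain :: "'w bet list \<Rightarrow> nat set \<Rightarrow> (nat \<Rightarrow> real) \<Rightarrow> 'w \<Rightarrow> real" where
  "gain bs J s w = (\<Sum>j\<in>J. s j * (payoff (bs ! j) w - price (bs ! j)))"

definition not_all_off :: "'w bet list \<Rightarrow> nat set \<Rightarrow> 'w set" where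
  "not_all_off bs J = {w. \<exists>j\<in>J. w \<notin> called_off (bs ! j)}"

definition coherent :: "'w bet list \<Rightarrow> bool" where
  "coherent bs \<longleftrightarrow>
    (\<forall>J s. J \<subseteq> {..<length bs} \<and> J \<noteq> {} \<longrightarrow>
      Min (gain bs J s ` not_all_off bs J) \<le> 0 \<and> 0 \<le> Max (gain bs J s ` not_all_off bs J))"

definition coherent_iter_extension ::
    "'w cond_event \<Rightarrow> 'w cond_event \<Rightarrow> real \<Rightarrow> real \<Rightarrow> real \<Rightarrow> bool" where
  "coherent_iter_extension X Y x y m \<longleftrightarrow>
    (\<exists>z. coherent [cond_bet X x, cond_bet Y y, cond_bet (conj_K X Y) z, iter_bet Y X x z m])"

end

theory Submission
  imports Defs
begin

text \<open>Write $X = A|H$, $Y = B|K$ and $C = X \wedge_K Y$. Everything rests on the numerical identity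
  $(Y|_K X) - \mu = (C - z) - \mu (X - x) + (z - x \mu)$: the iterated conditional is a linear
  combination of $C$ and $X$, up to a constant. Coherence forces the constant to vanish, since
  otherwise betting along this identity gives a riskless gain (\<open>conj_prevision_eq\<close>). Given
  $z = x \mu$, the bet on $Y|_K X$ alone forces $0 \le \mu \le 1$ (\<open>iter_prevision_bounds\<close>), and
  the pair $\{Y, C\}$ forces $z \le y$, that is, $x \mu \le y$ (\<open>conj_prevision_le\<close>).

  Conversely, put $z = x \mu$. Replacing all stakes by their opposites shows that it suffices to
  exclude gains that are positive wherever some bet is on (\<open>coherent_iff_no_sure_gain\<close>). By the
  identity, every gain is a combination $a (X - x) + b (Y - y) + c (C - z)$, and a gain that is
  positive everywhere has positive mean for every probability on the outcomes where some bet is on.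
  Such probabilities, carried by a few outcomes, produce the contradictions
  (\<open>coherent_iter_familyI\<close>). When the bet on $Y$ is
  present, two are needed. The upper Frechet-Hoeffding coupling on $H \wedge K$ gives the mean
  $c (\min \{x, y\} - z)$, hence $c > 0$; the law of $B$ given $K$, placed on
  $\overline{H} \wedge K$, gives the mean $- c z (1 - y)$, hence $c < 0$. This is why
  $z$ has no lower bound other than $0$: the conjunction may be true in $H \wedge K$
  while the mass that satisfies $P(B|K) = y$ lies outside $H$. When the bet on $Y$ is absent, a
  single probability, with mean $0$, suffices.\<close>

section \<open>Coherence as the absence of sure gain\<close>

lemma finite_range_gain:
  assumes "finite J" and "\<And>j. j \<in> J \<Longrightarrow> finite (range (payoff (bs ! j)))"
  shows "finite (range (gain bs J s))"
  using assms
proof (induction J rule: finite_induct)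
  case empty
  then show ?case by (simp add: gain_def)
next
  case (insert j J)
  let ?f = "\<lambda>(u, v). s j * (u - price (bs ! j)) + v"
  have "range (gain bs (insert j J) s)
      \<subseteq> ?f ` (range (payoff (bs ! j)) \<times> range (gain bs J s))"
    using insert.hyps by (force simp: gain_def image_iff)
  moreover have "finite (range (payoff (bs ! j)) \<times> range (gain bs J s))"
    using insert by simp
  ultimately show ?case by (meson finite_imageI finite_subset)
qed

lemma gain_uminus: "gain bs J (\<lambda>j. - s j) w = - gain bs J s w"
  by (simp add: gain_def sum_negf)

text \<open>The condition on the maximum is the one on the minimum for the opposite stakes. Finiteness of
  the ranges and the existence of an outcome where a bet is on make \<^const>\<open>Min\<close> and \<^const>\<open>Max\<close>
  meaningful.\<close>

lemma coherent_iff_no_sure_gain: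
  assumes fin: "\<And>j. j < length bs \<Longrightarrow> finite (range (payoff (bs ! j)))"
    and on: "\<And>j. j < length bs \<Longrightarrow> called_off (bs ! j) \<noteq> UNIV"
  shows "coherent bs \<longleftrightarrow> (\<forall>J s. J \<subseteq> {..<length bs} \<and> J \<noteq> {} \<longrightarrow>
    (\<exists>w\<in>not_all_off bs J. gain bs J s w \<le> 0))"
proof -
  have image: "finite (gain bs J s ` not_all_off bs J)" "gain bs J s ` not_all_off bs J \<noteq> {}"
    if J: "J \<subseteq> {..<length bs}" "J \<noteq> {}" for J s
  proof -
    have "finite (range (gain bs J s))"
      using J fin by (intro finite_range_gain) (auto intro: finite_subset)
    then show "finite (gain bs J s ` not_all_off bs J)"
      by (rule rev_finite_subset) auto
    obtain j where "j \<in> J" using J by blast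
    then obtain w where "w \<notin> called_off (bs ! j)" using J on by blast
    with \<open>j \<in> J\<close> show "gain bs J s ` not_all_off bs J \<noteq> {}"
      by (auto simp: not_all_off_def)
  qed
  show ?thesis
  proof (intro iffI allI impI)
    fix J s
    assume "coherent bs" and J: "J \<subseteq> {..<length bs} \<and> J \<noteq> {}"
    then have "Min (gain bs J s ` not_all_off bs J) \<le> 0"
      by (simp add: coherent_def)
    with J image[of J s] show "\<exists>w\<in>not_all_off bs J. gain bs J s w \<le> 0"
      by (auto simp: Min_le_iff)
  next
    assume *: "\<forall>J s. J \<subseteq> {..<length bs} \<and> J \<noteq> {} \<longrightarrow>
      (\<exists>w\<in>not_all_off bs J. gain bs J s w \<le> 0)"
    show "coherent bs"
      unfolding coherent_def
    proof (intro allI impI)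
      fix J s
      assume J: "J \<subseteq> {..<length bs} \<and> J \<noteq> {}"
      have "\<exists>w\<in>not_all_off bs J. gain bs J s w \<le> 0"
        using * J by blast
      moreover have "\<exists>w\<in>not_all_off bs J. gain bs J (\<lambda>j. - s j) w \<le> 0"
        using * J by blast
      ultimately show "Min (gain bs J s ` not_all_off bs J) \<le> 0 \<and>
          0 \<le> Max (gain bs J s ` not_all_off bs J)"
        using J image[of J s] by (auto simp: Min_le_iff Max_ge_iff gain_uminus)
    qed
  qed
qed

section \<open>The family of four bets\<close>

definition iter_family ::
    "'w cond_event \<Rightarrow> 'w cond_event \<Rightarrow> real \<Rightarrow> real \<Rightarrow> real \<Rightarrow> real \<Rightarrow> 'w bet list" where
  "iter_family X Y x y z m =
    [cond_bet X x, cond_bet Y y, cond_bet (conj_K X Y) z, iter_bet Y X x z m]"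

lemma length_iter_family [simp]: "length (iter_family X Y x y z m) = 4"
  by (simp add: iter_family_def)

text \<open>The stake on the iterated conditional is redistributed over the conditional events. For
  \<open>z = x * m\<close> nothing else remains.\<close>

lemma gain_iter_family:
  fixes X Y :: "'w cond_event" and s :: "nat \<Rightarrow> real"
  assumes J: "J \<subseteq> {..<4}"
  defines "t \<equiv> \<lambda>j. if j \<in> J then s j else 0"
  shows "gain (iter_family X Y x y z m) J s w =
    (t 0 - m * t 3) * (cond_value X x w - x) + t 1 * (cond_value Y y w - y)
    + (t 2 + t 3) * (cond_value (conj_K X Y) z w - z) + t 3 * (z - x * m)"
proof -
  let ?bs = "iter_family X Y x y z m"
  have "gain ?bs J s w = (\<Sum>j\<in>J. t j * (payoff (?bs ! j) w - price (?bs ! j)))"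
    unfolding gain_def t_def by (intro sum.cong) auto
  also have "\<dots> = (\<Sum>j<4. t j * (payoff (?bs ! j) w - price (?bs ! j)))"
    using J by (intro sum.mono_neutral_left) (auto simp: t_def)
  also have "{..<4::nat} = {0, 1, 2, 3}" by auto
  finally show ?thesis
    by (simp add: iter_family_def cond_bet_def iter_bet_def iter_value_def algebra_simps
        numeral_eq_Suc)
qed

lemma not_all_off_iter_family:
  assumes "J \<subseteq> {..<4}"
  shows "w \<in> not_all_off (iter_family X Y x y z m) J \<longleftrightarrow>
    0 \<in> J \<and> w \<notin> void_in X \<or> 1 \<in> J \<and> w \<notin> void_in Y \<or>
    2 \<in> J \<and> w \<notin> void_in (conj_K X Y) \<or> 3 \<in> J \<and> w \<notin> iter_off Y X x"
proof -
  have "(\<exists>j\<in>J. P j) \<longleftrightarrow> 0 \<in> J \<and> P 0 \<or> 1 \<in> J \<and> P 1 \<or> 2 \<in> J \<and> P 2 \<or> 3 \<in> J \<and> P 3" for P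
  proof -
    have "j \<in> {0, 1, 2, 3}" if "j \<in> J" for j
      using that assms by auto
    then show ?thesis by blast
  qed
  then show ?thesis
    by (auto simp: not_all_off_def iter_family_def cond_bet_def iter_bet_def numeral_eq_Suc)
qed

text \<open>Off \<open>H\<close> with \<open>B|K\<close> true or void the amount received is \<open>x * m + m * (1 - x)\<close>, always \<open>m\<close>; only
  two of the remaining cases depend on \<open>x\<close>.\<close>

lemma iter_off_iff:
  "w \<in> iter_off (Cond B K) (Cond A H) x \<longleftrightarrow>
    (if w \<in> H then w \<notin> A \<or> w \<notin> K \<and> x = 1 else w \<in> K \<longrightarrow> w \<in> B \<or> x = 0)"
proof -
  have val: "iter_value (Cond B K) (Cond A H) x (x * m) m w =
      (if w \<in> H then (if w \<in> A then (if w \<in> K then of_bool (w \<in> B) else x * m) else m)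
       else if w \<in> K \<and> w \<notin> B then m * (1 - x) else m)" for m
    by (auto simp: iter_value_def cond_value_def algebra_simps)
  have "\<not> (\<forall>m. m = c)" for c :: real
    by (metis zero_neq_one)
  moreover have "(\<forall>m. x * m = m) \<longleftrightarrow> x = 1"
    by (auto dest: spec[of _ 1])
  moreover have "(\<forall>m. m * (1 - x) = m) \<longleftrightarrow> x = 0"
    by (auto dest: spec[of _ 1])
  ultimately show ?thesis
    unfolding iter_off_def mem_Collect_eq val
    by (cases "w \<in> H"; cases "w \<in> A"; cases "w \<in> K"; cases "w \<in> B") simp_all
qed

lemma logically_independent_cell:
  assumes "logically_independent A B H K"
  obtains w where "w \<in> A \<longleftrightarrow> a" "w \<in> B \<longleftrightarrow> b" "w \<in> H \<longleftrightarrow> h" "w \<in> K \<longleftrightarrow> k"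
proof -
  define pick where "pick c S = (if c then S else - S)" for c and S :: "'a set"
  have "pick a A \<inter> pick b B \<inter> pick h H \<inter> pick k K \<noteq> {}"
    using assms by (simp add: logically_independent_def pick_def)
  then obtain w where w: "w \<in> pick a A" "w \<in> pick b B" "w \<in> pick h H" "w \<in> pick k K"
    by blast
  have "w \<in> S \<longleftrightarrow> c" if "w \<in> pick c S" for c S
    using that by (auto simp: pick_def split: if_splits)
  note this[OF w(1)] this[OF w(2)] this[OF w(3)] this[OF w(4)]
  then show thesis by (rule that)
qed

lemma finite_range_cond_value: "finite (range (cond_value X p))"
proof (rule finite_subset)
  show "range (cond_value X p) \<subseteq> {0, 1, p, 1 + p}"
    by (auto simp: cond_value_def)
qed simp

lemma finite_range_iter_value: "finite (range (iter_value Y X x z m))"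
proof (rule finite_subset)
  show "range (iter_value Y X x z m) \<subseteq> (\<lambda>(c, u). c + m * (1 - u)) `
      (range (cond_value (conj_K X Y) z) \<times> range (cond_value X x))"
    by (force simp: iter_value_def image_iff)
  show "finite \<dots>"
    by (intro finite_imageI finite_cartesian_product finite_range_cond_value)
qed

lemma coherent_iter_family_iff:
  assumes "logically_independent A B H K"
  defines "X \<equiv> Cond A H" and "Y \<equiv> Cond B K"
  shows "coherent (iter_family X Y x y z m) \<longleftrightarrow>
    (\<forall>J s. J \<subseteq> {..<4} \<and> J \<noteq> {} \<longrightarrow>
      (\<exists>w\<in>not_all_off (iter_family X Y x y z m) J. gain (iter_family X Y x y z m) J s w \<le> 0))"
proof -
  let ?bs = "iter_family X Y x y z m"
  obtain w where w: "w \<in> A" "w \<in> B" "w \<in> H" "w \<in> K"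
    using logically_independent_cell[OF assms(1), of True True True True] by blast
  have index: "j \<in> {0, 1, 2, 3}" if "j < 4" for j :: nat
    using that by auto
  have "finite (range (payoff (?bs ! j)))" if "j < length ?bs" for j
    using index[of j] that finite_range_cond_value finite_range_iter_value
    by (auto simp: iter_family_def cond_bet_def iter_bet_def numeral_eq_Suc)
  moreover have "called_off (?bs ! j) \<noteq> UNIV" if "j < length ?bs" for j
  proof -
    have "w \<notin> called_off (?bs ! j)"
      using index[of j] that w
      by (auto simp: iter_family_def cond_bet_def iter_bet_def numeral_eq_Suc X_def Y_def
          iter_off_iff)
    then show ?thesis by blast
  qed
  ultimately show ?thesis
    using coherent_iff_no_sure_gain[of ?bs] by simp
qed

section \<open>Necessary conditions\<close>

context
  fixes A B H K :: "'w set" and x y z m :: real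
  assumes indep: "logically_independent A B H K"
    and x: "0 \<le> x" "x \<le> 1" and y: "0 \<le> y" "y \<le> 1"
    and coh: "coherent (iter_family (Cond A H) (Cond B K) x y z m)"
begin

private abbreviation (input) "bs \<equiv> iter_family (Cond A H) (Cond B K) x y z m"

private lemma no_sure_gain:
  assumes "J \<subseteq> {..<4}" "J \<noteq> {}"
  obtains w where "w \<in> not_all_off bs J" "gain bs J s w \<le> 0"
  using coh assms unfolding coherent_iter_family_iff[OF indep] by blast

text \<open>These stakes on \<open>A|H\<close>, on the conjunction and on the iterated conditional make the gain the
  constant \<open>z - x * m\<close>, and their opposites the constant \<open>x * m - z\<close>.\<close>

lemma conj_prevision_eq: "z = x * m"
proof -
  let ?J = "{0, 2, 3} :: nat set"
  let ?s = "\<lambda>j. if j = 0 then m else if j = 2 then -1 else (1::real)"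
  have "gain bs ?J ?s w = z - x * m" for w
    by (subst gain_iter_family) auto
  moreover from this have "gain bs ?J (\<lambda>j. - ?s j) w = x * m - z" for w
    by (simp add: gain_uminus)
  moreover obtain w where "gain bs ?J ?s w \<le> 0"
    using no_sure_gain[of ?J ?s] by auto
  moreover obtain w where "gain bs ?J (\<lambda>j. - ?s j) w \<le> 0"
    using no_sure_gain[of ?J "\<lambda>j. - ?s j"] by auto
  ultimately show ?thesis by simp
qed

text \<open>Where the bet is on, the payoff minus \<open>m\<close> is \<open>1 - m\<close>, \<open>- m\<close>, \<open>- m * (1 - x)\<close> with
  \<open>x < 1\<close>, or \<open>- m * x\<close> with \<open>x > 0\<close>: all positive if \<open>m < 0\<close>, all negative if \<open>m > 1\<close>.\<close>

lemma iter_prevision_bounds: "0 \<le> m \<and> m \<le> 1"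
proof -
  have z: "z = x * m" by (rule conj_prevision_eq)
  have gain: "gain bs {3} (\<lambda>_. r) w = r *
      (if w \<in> H then (if w \<in> A then (if w \<in> K then of_bool (w \<in> B) - m else - m * (1 - x)) else 0)
       else if w \<in> K \<and> w \<notin> B then - m * x else 0)" for r w
    by (subst gain_iter_family) (auto simp: z cond_value_def algebra_simps)
  obtain w where w: "w \<notin> iter_off (Cond B K) (Cond A H) x" "gain bs {3} (\<lambda>_. 1) w \<le> 0"
    using no_sure_gain[of "{3}" "\<lambda>_. 1"] by (auto simp: not_all_off_iter_family)
  obtain w' where w': "w' \<notin> iter_off (Cond B K) (Cond A H) x" "gain bs {3} (\<lambda>_. -1) w' \<le> 0"
    using no_sure_gain[of "{3}" "\<lambda>_. -1"] by (auto simp: not_all_off_iter_family)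
  have "0 \<le> m"
  proof (rule ccontr)
    assume "\<not> 0 \<le> m"
    with w x show False
      by (auto simp: gain iter_off_iff mult_le_0_iff zero_le_mult_iff of_bool_def
          split: if_splits)
  qed
  moreover have "m \<le> 1"
  proof (rule ccontr)
    assume "\<not> m \<le> 1"
    with w' x show False
      by (auto simp: gain iter_off_iff mult_le_0_iff zero_le_mult_iff of_bool_def
          split: if_splits)
  qed
  ultimately show ?thesis ..
qed

text \<open>The conjunction implies \<open>B|K\<close>: selling the former and buying the latter gains at least
  \<open>min (z - y) (1 - y)\<close> wherever one of the two bets is on, which would be a sure gain for
  \<open>y < z \<le> 1\<close>.\<close>

lemma conj_prevision_le: "z \<le> y"
proof (rule ccontr)
  assume "\<not> z \<le> y"
  then have "y < z" by simp
  moreover have "z \<le> 1"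
    using conj_prevision_eq iter_prevision_bounds x by (simp add: mult_le_one)
  moreover define r :: "nat \<Rightarrow> real" where "r = (\<lambda>j. if j = 1 then 1 else -1)"
  moreover obtain w where w: "w \<in> not_all_off bs {1, 2}" "gain bs {1, 2} r w \<le> 0"
    using no_sure_gain[of "{1, 2}" r] by auto
  ultimately show False
    using y by (auto simp: gain_iter_family not_all_off_iter_family cond_value_def of_bool_def
        split: if_splits)
qed

end

section \<open>Sufficient conditions\<close>

lemma weighted_sum_pos:
  fixes p q r t a b c d :: real
  assumes "0 \<le> p" "0 \<le> q" "0 \<le> r" "0 \<le> t" "p + q + r + t = 1"
    and "0 < a" "0 < b" "0 < c" "0 < d"
  shows "0 < p * a + q * b + r * c + t * d"
proof -
  have "0 \<le> p * a" "0 \<le> q * b" "0 \<le> r * c" "0 \<le> t * d"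
    using assms by simp_all
  moreover have "0 < p \<or> 0 < q \<or> 0 < r \<or> 0 < t"
    using assms by linarith
  then have "0 < p * a \<or> 0 < q * b \<or> 0 < r * c \<or> 0 < t * d"
    using assms by auto
  ultimately show ?thesis by linarith
qed

text \<open>In the three arguments below \<open>g\<close> stands for the gain, which is supposed positive wherever some
  bet is on, and the weights given to \<open>weighted_sum_pos\<close> are the probabilities of the constituents
  under the law with respect to which the mean of the gain is computed.\<close>

lemma coherent_iter_familyI:
  fixes A B H K :: "'w set" and x y m :: real
  assumes indep: "logically_independent A B H K"
    and x: "0 \<le> x" "x \<le> 1" and y: "0 \<le> y" "y \<le> 1"
    and m: "0 \<le> m" "m \<le> 1" and le: "x * m \<le> y"
  shows "coherent (iter_family (Cond A H) (Cond B K) x y (x * m) m)"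
  unfolding coherent_iter_family_iff[OF indep]
proof (intro allI impI, elim conjE, rule ccontr)
  let ?bs = "iter_family (Cond A H) (Cond B K) x y (x * m) m"
  fix J :: "nat set" and s
  assume J: "J \<subseteq> {..<4}" "J \<noteq> {}"
  assume "\<not> (\<exists>w\<in>not_all_off ?bs J. gain ?bs J s w \<le> 0)"
  then have pos: "0 < gain ?bs J s w" if "w \<in> not_all_off ?bs J" for w
    using that by force
  define t where "t = (\<lambda>j. if j \<in> J then s j else 0)"
  define z where "z = x * m"
  define a b c where "a = t 0 - m * t 3" and "b = t 1" and "c = t 2 + t 3"
  define g where "g w = gain ?bs J s w" for w
  have g: "g w = a * (cond_value (Cond A H) x w - x) + b * (cond_value (Cond B K) y w - y)
      + c * (cond_value (conj_K (Cond A H) (Cond B K)) z w - z)" for w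
    unfolding g_def a_def b_def c_def t_def z_def
    by (subst gain_iter_family[OF J(1)]) simp
  have z: "0 \<le> z" "z \<le> x" "z \<le> y"
    using x m le by (simp_all add: z_def mult_left_le)
  note on = not_all_off_iter_family[OF J(1)]
  note cell = logically_independent_cell[OF indep]
  obtain w1 where w1: "w1 \<in> A" "w1 \<in> B" "w1 \<in> H" "w1 \<in> K"
    using cell[of True True True True] by blast
  obtain w2 where w2: "w2 \<in> A" "w2 \<notin> B" "w2 \<in> H" "w2 \<in> K"
    using cell[of True False True True] by blast
  obtain w3 where w3: "w3 \<notin> A" "w3 \<in> B" "w3 \<in> H" "w3 \<in> K"
    using cell[of False True True True] by blast
  obtain w4 where w4: "w4 \<notin> A" "w4 \<notin> B" "w4 \<in> H" "w4 \<in> K"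
    using cell[of False False True True] by blast
  obtain w5 where w5: "w5 \<in> A" "w5 \<in> B" "w5 \<notin> H" "w5 \<in> K"
    using cell[of True True False True] by blast
  obtain w6 where w6: "w6 \<in> A" "w6 \<notin> B" "w6 \<notin> H" "w6 \<in> K"
    using cell[of True False False True] by blast
  have gw: "g w1 = a * (1 - x) + b * (1 - y) + c * (1 - z)"
    "g w2 = a * (1 - x) - b * y - c * z"
    "g w3 = - a * x + b * (1 - y) - c * z"
    "g w4 = - a * x - b * y - c * z"
    "g w5 = b * (1 - y)"
    "g w6 = - b * y - c * z"
    using w1 w2 w3 w4 w5 w6 by (simp_all add: g cond_value_def)
  consider "1 \<in> J" | "1 \<notin> J" "0 \<in> J \<or> 2 \<in> J" | "J = {3}"
  proof -
    have "J \<subseteq> {0, 1, 2, 3}" using J(1) by auto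
    with J(2) that show thesis by blast
  qed
  then show False
  proof cases
    case 1
    have gpos: "0 < g w1" "0 < g w2" "0 < g w3" "0 < g w4" "0 < g w5" "0 < g w6"
      unfolding g_def using 1 w1 w2 w3 w4 w5 w6 by (intro pos; simp add: on)+
    define M where "M = min x y"
    have M: "0 \<le> M" "M \<le> x" "M \<le> y" "x + y - 1 \<le> M" "z \<le> M"
      using x y z by (auto simp: M_def)
    \<comment> \<open>The coupling of the laws of \<open>A\<close> and \<open>B\<close> that makes their intersection most probable.\<close>
    have "0 < M * g w1 + (x - M) * g w2 + (y - M) * g w3 + (1 - x - y + M) * g w4"
      using gpos M by (intro weighted_sum_pos) auto
    also have "\<dots> = c * (M - z)"
      by (simp add: gw algebra_simps)
    finally have "0 < c"
      using M by (simp add: zero_less_mult_iff)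
    \<comment> \<open>Off \<open>H\<close> the conjunction can be false but not true, and the bet on \<open>A|H\<close> is void.\<close>
    moreover have "0 < y * g w5 + (1 - y) * g w6 + 0 * g w1 + 0 * g w1"
      using gpos y by (intro weighted_sum_pos) auto
    then have "0 < - (c * (z * (1 - y)))"
      by (simp add: gw algebra_simps)
    ultimately show False
      using z y by (simp add: mult_less_0_iff)
  next
    case 2
    then have "b = 0" by (simp add: b_def t_def)
    have gpos: "0 < g w1" "0 < g w2" "0 < g w4"
      unfolding g_def using 2 w1 w2 w4 by (intro pos; auto simp: on)+
    \<comment> \<open>Without a bet on \<open>B|K\<close>, \<open>B\<close> can be given any law: here \<open>P(HK) = 1\<close>,
      \<open>P(AB) = z\<close> and \<open>P(A) = x\<close>.\<close>
    have "0 < z * g w1 + (x - z) * g w2 + (1 - x) * g w4 + 0 * g w1"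
      using gpos x z by (intro weighted_sum_pos) auto
    also have "\<dots> = 0"
      by (simp add: gw \<open>b = 0\<close> algebra_simps)
    finally show False by simp
  next
    case 3
    then have coeffs: "b = 0" "a = - m * c"
      by (simp_all add: a_def b_def c_def t_def)
    have "3 \<in> J" using 3 by simp
    then have gpos: "0 < g w1" "0 < g w2"
      unfolding g_def using w1 w2 by (intro pos; simp add: on iter_off_iff)+
    \<comment> \<open>The bet is off when \<open>A|H\<close> is false, so the law is conditioned on \<open>A|H\<close> being true: \<open>m\<close>
      is the probability of \<open>B\<close> there.\<close>
    have "0 < m * g w1 + (1 - m) * g w2 + 0 * g w1 + 0 * g w1"
      using gpos m by (intro weighted_sum_pos) auto
    also have "\<dots> = 0"
      by (simp add: gw coeffs z_def algebra_simps)
    finally show False by simp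
  qed
qed

theorem theorem12:
  fixes A B H K :: "'w set" and x y \<mu> :: real
  assumes "logically_independent A B H K"
    and "x \<in> {0..1}" and "y \<in> {0..1}"
  shows "coherent_iter_extension (Cond A H) (Cond B K) x y \<mu> \<longleftrightarrow>
    \<mu> \<in> {0 .. (if x > 0 then min 1 (y / x) else 1)}"
proof -
  have xy: "0 \<le> x" "x \<le> 1" "0 \<le> y" "y \<le> 1"
    using assms by auto
  have "coherent_iter_extension (Cond A H) (Cond B K) x y \<mu> \<longleftrightarrow>
      (\<exists>z. coherent (iter_family (Cond A H) (Cond B K) x y z \<mu>))"
    by (simp add: coherent_iter_extension_def iter_family_def)
  also have "\<dots> \<longleftrightarrow> 0 \<le> \<mu> \<and> \<mu> \<le> 1 \<and> x * \<mu> \<le> y"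
  proof
    assume "\<exists>z. coherent (iter_family (Cond A H) (Cond B K) x y z \<mu>)"
    then obtain z where coh: "coherent (iter_family (Cond A H) (Cond B K) x y z \<mu>)" ..
    note hyps = assms(1) xy coh
    show "0 \<le> \<mu> \<and> \<mu> \<le> 1 \<and> x * \<mu> \<le> y"
      using conj_prevision_eq[OF hyps] iter_prevision_bounds[OF hyps] conj_prevision_le[OF hyps]
      by simp
  next
    assume "0 \<le> \<mu> \<and> \<mu> \<le> 1 \<and> x * \<mu> \<le> y"
    then show "\<exists>z. coherent (iter_family (Cond A H) (Cond B K) x y z \<mu>)"
      using coherent_iter_familyI[OF assms(1) xy] by blast
  qed
  also have "\<dots> \<longleftrightarrow> \<mu> \<in> {0 .. (if x > 0 then min 1 (y / x) else 1)}"
  proof (cases "x > 0")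
    case True
    then show ?thesis by (auto simp: pos_le_divide_eq mult.commute)
  next
    case False
    with xy have "x = 0" by simp
    with xy show ?thesis by auto
  qed
  finally show ?thesis .
qed

end
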